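(* Let $\mathcal{B}$ be a real Banach space having a pre-dual space $\mathcal{B}_*$, let $\nu_1,\dots,\nu_n\in\mathcal{B}_*$ be linearly independent, let $\mathbf{y}=[y_1,\dots,y_n]\in\mathbb{R}^n\setminus\{\mathbf{0}\}$, and let $\mathcal{M}_{\mathbf{y}}:=\{f\in\mathcal{B}:\langle\nu_j,f\rangle_{\mathcal{B}}=y_j,\ j=1,\dots,n\}$. Put $m_0:=\inf\{\|f\|_{\mathcal{B}}:f\in\mathcal{M}_{\mathbf{y}}\}$ and let $\hat{\mathbf{c}}=[\hat c_1,\dots,\hat c_n]\in\mathbb{R}^n$ be a solution of $$\sup\Bigl\{\sum_{j=1}^nc_jy_j:\mathbf{c}\in\mathbb{R}^n,\ \Bigl\|\sum_{j=1}^nc_j\nu_j\Bigr\|_{\mathcal{B}_*}=1\Bigr\}.$$ Then $\hat\nu:=m_0\sum_{j=1}^n\hat c_j\nu_j$ satisfies $$\bigl(\|\hat\nu\|_{\mathcal{B}_*}\,\partial\|\cdot\|_{\mathcal{B}_*}(\hat\nu)\bigr)\cap\mathcal{M}_{\mathbf{y}}\neq\emptyset .$$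
   Context: A Banach space $\mathcal{B}$ has a pre-dual space $\mathcal{B}_*$ if $\mathcal{B}_*$ is a Banach space with $(\mathcal{B}_* )^*=\mathcal{B}$ (isometric identification). Elements $\nu\in\mathcal{B}_*$ act on $\mathcal{B}$ by $\langle\nu,f\rangle_{\mathcal{B}}=\langle f,\nu\rangle_{\mathcal{B}_*}=f(\nu)$. $\partial\|\cdot\|_{\mathcal{B}_*}(\nu)\subset\mathcal{B}$ is the subdifferential of the norm of $\mathcal{B}_*$ at $\nu$. *)

theory Defs
  imports "HOL-Analysis.Analysis"
begin

text \<open>
  A pre-dual of a Banach space (type \<open>'b\<close>) is a Banach space (type \<open>'a\<close>) together with an
  isometric isomorphism \<open>J\<close> of \<open>'b\<close> onto the dual of \<open>'a\<close>. An element \<open>\<nu>\<close> of the pre-dual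
  acts on \<open>f\<close> by the pairing \<open>blinfun_apply (J f) \<nu>\<close>.
\<close>

definition predual_identification :: "('b::banach \<Rightarrow> ('a::banach \<Rightarrow>\<^sub>L real)) \<Rightarrow> bool" where
  "predual_identification J \<longleftrightarrow> linear J \<and> bij J \<and> (\<forall>f. norm (J f) = norm f)"

definition subdifferential :: "('a::real_normed_vector \<Rightarrow> real) \<Rightarrow> 'a \<Rightarrow> ('a \<Rightarrow>\<^sub>L real) set" where
  "subdifferential \<phi> x = {g. \<forall>z. \<phi> z - \<phi> x \<ge> blinfun_apply g (z - x)}"

text \<open>The subdifferential of the pre-dual norm, regarded as a subset of the space itself via \<open>J\<close>.\<close>

definition predual_norm_subdifferential ::
    "('b::banach \<Rightarrow> ('a::banach \<Rightarrow>\<^sub>L real)) \<Rightarrow> 'a \<Rightarrow> 'b set" where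
  "predual_norm_subdifferential J \<nu> = {f. J f \<in> subdifferential norm \<nu>}"

definition interpolants ::
    "('b::banach \<Rightarrow> ('a::banach \<Rightarrow>\<^sub>L real)) \<Rightarrow> ('n::finite \<Rightarrow> 'a) \<Rightarrow> real ^ 'n \<Rightarrow> 'b set" where
  "interpolants J \<nu> y = {f. \<forall>j. blinfun_apply (J f) (\<nu> j) = y $ j}"

end

theory Submission
  imports Defs
begin

text \<open>
  Write \<open>S c\<close> for \<open>\<Sum>j. c j \<nu> j\<close>. Linear independence turns the interpolation conditions into a
  single linear functional \<open>L\<close> with \<open>L (\<nu> j) = y j\<close>, so the supremum in the hypothesis
  is the norm \<open>M\<close> of \<open>L\<close> restricted to the span of the \<open>\<nu> j\<close>, and it is attained
  at the unit vector \<open>u = S c_hat\<close>. It is positive since \<open>L (S y)\<close> is the sum of the squares of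
  the entries of \<open>y\<close>.

  The Hahn-Banach theorem (\<open>Hahn_Banach_norm\<close>) extends \<open>L\<close> from the span to a functional \<open>g\<close> on
  the whole pre-dual with \<open>norm g \<le> M\<close>; being in the dual of the pre-dual, \<open>g\<close> is an
  element \<open>f0\<close> of the Banach space, and it interpolates. Every interpolant takes the value \<open>M\<close> at
  \<open>u\<close> and so has norm at least \<open>M\<close>. Hence \<open>m0 = M\<close>, \<open>f0\<close> has minimal norm, and
  \<open>\<nu>_hat = M u\<close> has norm \<open>M\<close>. Since \<open>g / M\<close> has norm at most one and attains the norm of \<open>\<nu>_hat\<close>
  there, it is a subgradient (\<open>scaled_maximizer_subgradient\<close>), and
  multiplying it by \<open>M\<close> gives back the interpolant \<open>f0\<close>.

  The Hahn-Banach theorem is proved through minimal sublinear functionals. Lowering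
  a sublinear functional \<open>p\<close> so that it stays below a given functional on a convex cone
  (\<open>sublinear_inf_convolution\<close>) serves twice: on a subspace it pushes \<open>p\<close> below \<open>L\<close>, so that
  every linear functional under the result extends \<open>L\<close>, and on a ray it shows that a functional
  which cannot be lowered further is odd, hence linear. By Zorn's lemma there is such a minimal functional below any sublinear one.
\<close>

section \<open>Sublinear functionals\<close>

text \<open>
  Homogeneity is required only as an inequality, which is what has to be checked for an infimum.
  On the whole space the equality follows, by scaling back with the inverse factor.
\<close>

definition sublinear_on :: "'a::real_vector set \<Rightarrow> ('a \<Rightarrow> real) \<Rightarrow> bool" where
  "sublinear_on C p \<longleftrightarrow>
     (\<forall>x\<in>C. \<forall>y\<in>C. p (x + y) \<le> p x + p y) \<and> (\<forall>x\<in>C. \<forall>t\<ge>0. p (t *\<^sub>R x) \<le> t * p x)"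

abbreviation sublinear :: "('a::real_vector \<Rightarrow> real) \<Rightarrow> bool" where
  "sublinear \<equiv> sublinear_on UNIV"

lemma sublinear_onI:
  assumes "\<And>x y. x \<in> C \<Longrightarrow> y \<in> C \<Longrightarrow> p (x + y) \<le> p x + p y"
    and "\<And>t x. x \<in> C \<Longrightarrow> 0 \<le> t \<Longrightarrow> p (t *\<^sub>R x) \<le> t * p x"
  shows "sublinear_on C p"
  using assms by (auto simp: sublinear_on_def)

lemma sublinear_onD:
  assumes "sublinear_on C p"
  shows sublinear_on_add: "x \<in> C \<Longrightarrow> y \<in> C \<Longrightarrow> p (x + y) \<le> p x + p y"
    and sublinear_on_scaleR: "x \<in> C \<Longrightarrow> 0 \<le> t \<Longrightarrow> p (t *\<^sub>R x) \<le> t * p x"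
  using assms by (auto simp: sublinear_on_def)

lemma sublinear_zero:
  assumes "sublinear p"
  shows "p 0 = 0"
  using sublinear_on_add[OF assms, of 0 0] sublinear_on_scaleR[OF assms, of 0 0] by simp

lemma sublinear_scaleR:
  assumes "sublinear p" and "0 \<le> t"
  shows "p (t *\<^sub>R x) = t * p x"
proof (cases "t = 0")
  case True
  then show ?thesis using sublinear_zero[OF assms(1)] by simp
next
  case False
  with assms(2) have t: "t > 0" by simp
  have "p x \<le> inverse t * p (t *\<^sub>R x)"
    using sublinear_on_scaleR[OF assms(1), of "t *\<^sub>R x" "inverse t"] t by simp
  then have "t * p x \<le> p (t *\<^sub>R x)"
    using t by (simp add: field_simps)
  then show ?thesis
    using sublinear_on_scaleR[OF assms(1) UNIV_I assms(2), of x] by simp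
qed

lemma sublinear_minus_ge:
  assumes "sublinear p"
  shows "- p (- x) \<le> p x"
  using sublinear_on_add[OF assms, of x "- x"] sublinear_zero[OF assms] by simp

lemma linear_imp_sublinear_on: "linear f \<Longrightarrow> sublinear_on C f"
  by (simp add: sublinear_on_def linear_add linear_scale)

text \<open>
  Applying subadditivity to \<open>- x\<close> and \<open>- y\<close> and using oddness reverses the inequality for
  \<open>x\<close> and \<open>y\<close>.
\<close>

lemma linear_if_sublinear_odd:
  assumes p: "sublinear p" and odd: "\<And>x. p (- x) \<le> - p x"
  shows "linear p"
proof -
  have minus: "p (- x) = - p x" for x
    using odd[of x] sublinear_minus_ge[OF p, of x] by simp
  show ?thesis
  proof (rule linearI)
    fix x y
    show "p (x + y) = p x + p y"
      using sublinear_on_add[OF p, of x y] sublinear_on_add[OF p, of "- x" "- y"]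
        minus[of "x + y"] minus[of x] minus[of y] by simp
  next
    fix t x
    show "p (t *\<^sub>R x) = t *\<^sub>R p x"
    proof (cases "0 \<le> t")
      case True
      then show ?thesis using sublinear_scaleR[OF p] by simp
    next
      case False
      then have "p ((- t) *\<^sub>R x) = (- t) * p x"
        by (intro sublinear_scaleR[OF p]) simp
      then show ?thesis using minus[of "t *\<^sub>R x"] by simp
    qed
  qed
qed

lemma le_INF_add_INF:
  fixes f :: "'i \<Rightarrow> real" and g :: "'j \<Rightarrow> real"
  assumes "A \<noteq> {}" and "B \<noteq> {}" and "\<And>i j. i \<in> A \<Longrightarrow> j \<in> B \<Longrightarrow> z \<le> f i + g j"
  shows "z \<le> (INF i\<in>A. f i) + (INF j\<in>B. g j)"
proof -
  have "z - f i \<le> (INF j\<in>B. g j)" if "i \<in> A" for i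
    using assms(2) by (rule cINF_greatest) (use assms(3)[OF that] in \<open>simp add: algebra_simps\<close>)
  then have "z - (INF j\<in>B. g j) \<le> (INF i\<in>A. f i)"
    by (intro cINF_greatest[OF assms(1)]) (simp add: algebra_simps)
  then show ?thesis by simp
qed

lemma le_mult_INF:
  fixes f :: "'i \<Rightarrow> real"
  assumes "A \<noteq> {}" and "0 < t" and "\<And>i. i \<in> A \<Longrightarrow> z \<le> t * f i"
  shows "z \<le> t * (INF i\<in>A. f i)"
proof -
  have "z / t \<le> (INF i\<in>A. f i)"
    by (rule cINF_greatest[OF assms(1)]) (use assms in \<open>simp add: field_simps\<close>)
  then show ?thesis using assms(2) by (simp add: field_simps)
qed

text \<open>
  The functional is the infimal convolution of \<open>p\<close> with \<open>h\<close>, where \<open>h\<close> counts as infinite outside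
  the cone. The compatibility of \<open>p\<close> and \<open>h\<close> is exactly what bounds the infimum from below:
  \<open>p (x - s) + h s \<ge> p (x - s) - p (- s) \<ge> - p (- x)\<close>. Taking \<open>s = 0\<close> gives the bound by
  \<open>p\<close>, and taking \<open>s = x\<close> the bound by \<open>h\<close> on the cone.
\<close>

lemma sublinear_inf_convolution:
  fixes p h :: "'a::real_vector \<Rightarrow> real"
  assumes p: "sublinear p" and C: "convex_cone C" and h: "sublinear_on C h"
    and ph: "\<And>s. s \<in> C \<Longrightarrow> - p (- s) \<le> h s"
  obtains r where "sublinear r" and "\<And>x. r x \<le> p x" and "\<And>s. s \<in> C \<Longrightarrow> r s \<le> h s"
proof
  define r where "r = (\<lambda>x. INF s\<in>C. p (x - s) + h s)"
  have C0: "0 \<in> C" and Cadd: "\<And>s s'. s \<in> C \<Longrightarrow> s' \<in> C \<Longrightarrow> s + s' \<in> C"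
    and Cscale: "\<And>t s. 0 \<le> t \<Longrightarrow> s \<in> C \<Longrightarrow> t *\<^sub>R s \<in> C"
    using C by (auto simp: convex_cone_contains_0 convex_cone_add convex_cone_scaleR)
  then have ne: "C \<noteq> {}" by blast
  have h0: "h 0 \<le> 0"
    using sublinear_on_scaleR[OF h C0, of 0] by simp
  have bdd: "bdd_below ((\<lambda>s. p (x - s) + h s) ` C)" for x
  proof (rule bdd_belowI2)
    fix s assume "s \<in> C"
    then show "- p (- x) \<le> p (x - s) + h s"
      using ph[of s] sublinear_on_add[OF p, of "x - s" "- x"] by simp
  qed
  have le: "r x \<le> p (x - s) + h s" if "s \<in> C" for x s
    unfolding r_def by (rule cINF_lower[OF bdd that])
  show r_le: "r x \<le> p x" for x
    using le[OF C0, of x] h0 by simp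
  show "r s \<le> h s" if "s \<in> C" for s
    using le[OF that, of s] sublinear_zero[OF p] by simp
  show "sublinear r"
  proof (rule sublinear_onI)
    fix x y
    show "r (x + y) \<le> r x + r y"
      unfolding r_def[THEN fun_cong, of x] r_def[THEN fun_cong, of y]
    proof (rule le_INF_add_INF[OF ne ne])
      fix s s' assume s: "s \<in> C" "s' \<in> C"
      have "r (x + y) \<le> p (x + y - (s + s')) + h (s + s')"
        by (rule le[OF Cadd[OF s]])
      also have "\<dots> \<le> (p (x - s) + p (y - s')) + (h s + h s')"
        using sublinear_on_add[OF p, of "x - s" "y - s'"] sublinear_on_add[OF h s]
        by (simp add: algebra_simps)
      finally show "r (x + y) \<le> p (x - s) + h s + (p (y - s') + h s')"
        by simp
    qed
  next
    fix t :: real and x assume "0 \<le> t"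
    then consider "t = 0" | "0 < t" by linarith
    then show "r (t *\<^sub>R x) \<le> t * r x"
    proof cases
      case 1
      then show ?thesis using r_le[of 0] sublinear_zero[OF p] by simp
    next
      case 2
      show ?thesis
        unfolding r_def[THEN fun_cong, of x]
      proof (rule le_mult_INF[OF ne 2])
        fix s assume s: "s \<in> C"
        have "r (t *\<^sub>R x) \<le> p (t *\<^sub>R (x - s)) + h (t *\<^sub>R s)"
          using le[OF Cscale[of t s], of "t *\<^sub>R x"] 2 s by (simp add: algebra_simps)
        also have "\<dots> \<le> t * p (x - s) + t * h s"
          using sublinear_scaleR[OF p, of t "x - s"] sublinear_on_scaleR[OF h s, of t] 2 by simp
        finally show "r (t *\<^sub>R x) \<le> t * (p (x - s) + h s)"
          by (simp add: algebra_simps)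
      qed
    qed
  qed
qed

section \<open>The Hahn-Banach theorem\<close>

text \<open>
  For a pointwise infimum, subadditivity needs a single member of the family that is below
  two given ones; this is where the chain condition enters. The infimum is finite because
  \<open>- p (- x) \<le> - q (- x) \<le> q x\<close> for each member \<open>q\<close>.
\<close>

lemma sublinear_INF_chain:
  fixes p :: "'a::real_vector \<Rightarrow> real"
  assumes ne: "Q \<noteq> {}" and Q: "\<And>q. q \<in> Q \<Longrightarrow> sublinear q"
    and Qp: "\<And>q x. q \<in> Q \<Longrightarrow> q x \<le> p x"
    and chain: "\<And>q q'. q \<in> Q \<Longrightarrow> q' \<in> Q \<Longrightarrow> q \<le> q' \<or> q' \<le> q"
  obtains r where "sublinear r" and "\<And>q x. q \<in> Q \<Longrightarrow> r x \<le> q x"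
proof
  define r where "r = (\<lambda>x. INF q\<in>Q. q x)"
  have bdd: "bdd_below ((\<lambda>q. q x) ` Q)" for x
  proof (rule bdd_belowI2)
    fix q assume "q \<in> Q"
    then show "- p (- x) \<le> q x"
      using sublinear_minus_ge[OF Q, of q x] Qp[of q "- x"] by simp
  qed
  show le: "r x \<le> q x" if "q \<in> Q" for q x
    unfolding r_def by (rule cINF_lower[OF bdd that])
  show "sublinear r"
  proof (rule sublinear_onI)
    fix x y
    show "r (x + y) \<le> r x + r y"
      unfolding r_def[THEN fun_cong, of x] r_def[THEN fun_cong, of y]
    proof (rule le_INF_add_INF[OF ne ne])
      fix q q' assume q: "q \<in> Q" "q' \<in> Q"
      then obtain k where k: "k \<in> Q" "k \<le> q" "k \<le> q'"
        using chain[OF q] by blast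
      have "r (x + y) \<le> k (x + y)" by (rule le[OF k(1)])
      also have "\<dots> \<le> k x + k y" by (rule sublinear_on_add[OF Q[OF k(1)]]) auto
      also have "\<dots> \<le> q x + q' y" using k by (intro add_mono) (auto simp: le_fun_def)
      finally show "r (x + y) \<le> q x + q' y" .
    qed
  next
    fix t :: real and x assume "0 \<le> t"
    then consider "t = 0" | "0 < t" by linarith
    then show "r (t *\<^sub>R x) \<le> t * r x"
    proof cases
      case 1
      obtain q where "q \<in> Q" using ne by blast
      then show ?thesis using 1 le[of q 0] sublinear_zero[OF Q] by fastforce
    next
      case 2
      show ?thesis
        unfolding r_def[THEN fun_cong, of x]
      proof (rule le_mult_INF[OF ne 2])
        fix q assume q: "q \<in> Q"
        show "r (t *\<^sub>R x) \<le> t * q x"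
          using le[OF q, of "t *\<^sub>R x"] sublinear_scaleR[OF Q[OF q], of t x] 2 by simp
      qed
    qed
  qed
qed

lemma minimal_sublinear_exists:
  fixes p :: "'a::real_vector \<Rightarrow> real"
  assumes p: "sublinear p"
  obtains q where "sublinear q" and "q \<le> p" and "\<And>r. sublinear r \<Longrightarrow> r \<le> q \<Longrightarrow> r = q"
proof -
  define A where "A = {q. sublinear q \<and> q \<le> p}"
  \<comment> \<open>Zorn's lemma yields maximal elements, so it is applied to the reversed pointwise order.\<close>
  have "\<exists>m\<in>A. \<forall>a\<in>A. a \<le> m \<longrightarrow> a = m"
  proof (rule predicate_Zorn)
    show "partial_order_on A (relation_of (\<lambda>x y. y \<le> x) A)"
      by (rule partial_order_on_relation_ofI) auto
  next
    fix Q assume Q: "Q \<in> Chains (relation_of (\<lambda>x y. y \<le> x) A)"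
    then have QA: "Q \<subseteq> A" and chain: "\<And>q q'. q \<in> Q \<Longrightarrow> q' \<in> Q \<Longrightarrow> q \<le> q' \<or> q' \<le> q"
      by (auto simp: Chains_def relation_of_def)
    show "\<exists>u\<in>A. \<forall>a\<in>Q. u \<le> a"
    proof (cases "Q = {}")
      case True
      then show ?thesis using p by (auto simp: A_def)
    next
      case False
      have Qs: "sublinear q" and Qp: "q x \<le> p x" if "q \<in> Q" for q x
        using that QA by (auto simp: A_def le_fun_def)
      obtain r where r: "sublinear r" "\<And>q x. q \<in> Q \<Longrightarrow> r x \<le> q x"
        using sublinear_INF_chain[of Q p] False Qs Qp chain by metis
      obtain q where "q \<in> Q" using False by blast
      then have "r \<le> p"
        unfolding le_fun_def using r(2) Qp order_trans by blast
      then show ?thesis using r by (auto simp: A_def le_fun_def)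
    qed
  qed
  then obtain m where m: "sublinear m" "m \<le> p"
    and min: "\<And>r. sublinear r \<Longrightarrow> r \<le> p \<Longrightarrow> r \<le> m \<Longrightarrow> r = m"
    by (auto simp: A_def)
  show thesis
    by (rule that[OF m]) (use min m(2) order_trans in blast)
qed

text \<open>
  On the ray through \<open>- a\<close> the functional \<open>s \<mapsto> - q (- s)\<close> is additive, and \<open>q\<close> can be lowered to
  lie below it there. If \<open>q\<close> is minimal, the lowering changes nothing, so that
  \<open>q (- a) \<le> - q a\<close>.
\<close>

lemma minimal_sublinear_imp_linear:
  fixes q :: "'a::real_vector \<Rightarrow> real"
  assumes q: "sublinear q" and min: "\<And>r. sublinear r \<Longrightarrow> r \<le> q \<Longrightarrow> r = q"
  shows "linear q"
proof (rule linear_if_sublinear_odd[OF q])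
  fix a :: 'a
  define C where "C = (\<lambda>t. t *\<^sub>R (- a)) ` {0..}"
  have "convex_cone {0::real..}"
    by (auto simp: convex_cone_iff)
  then have "convex_cone C"
    unfolding C_def
    by (intro convex_cone_linear_image conjI linearI) (simp_all add: algebra_simps)
  moreover have "sublinear_on C (\<lambda>s. - q (- s))"
  proof (rule sublinear_onI)
    fix x y assume "x \<in> C" "y \<in> C"
    then obtain t u where "x = t *\<^sub>R (- a)" "y = u *\<^sub>R (- a)" "0 \<le> t" "0 \<le> u"
      by (auto simp: C_def)
    then show "- q (- (x + y)) \<le> - q (- x) + - q (- y)"
      using sublinear_scaleR[OF q, of "t + u" a] sublinear_scaleR[OF q, of t a]
        sublinear_scaleR[OF q, of u a]
      by (simp add: algebra_simps)
  next
    fix t :: real and x assume "0 \<le> t"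
    then show "- q (- (t *\<^sub>R x)) \<le> t * - q (- x)"
      using sublinear_scaleR[OF q, of t "- x"] by simp
  qed
  ultimately obtain r where r: "sublinear r" "\<And>x. r x \<le> q x"
    and rC: "\<And>s. s \<in> C \<Longrightarrow> r s \<le> - q (- s)"
    using sublinear_inf_convolution[OF q, of C "\<lambda>s. - q (- s)"] by blast
  have "r = q"
    using r by (intro min) (auto simp: le_fun_def)
  moreover have "- a \<in> C"
    by (auto simp: C_def intro!: rev_image_eqI[of 1])
  ultimately show "q (- a) \<le> - q a"
    using rC[of "- a"] by simp
qed

text \<open>
  The functional on the subspace is given as the restriction of a linear functional \<open>L\<close> on the
  whole space; this is no loss, since every linear functional on a subspace extends linearly.
  Lowering \<open>p\<close> below \<open>L\<close> on \<open>V\<close> leaves only one-sided bounds to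
  preserve: a linear functional below \<open>L\<close> on a subspace equals \<open>L\<close> there.
\<close>

theorem Hahn_Banach_sublinear:
  fixes p L :: "'a::real_vector \<Rightarrow> real"
  assumes p: "sublinear p" and V: "subspace V" and L: "linear L"
    and Lp: "\<And>v. v \<in> V \<Longrightarrow> L v \<le> p v"
  obtains g where "linear g" and "\<And>v. v \<in> V \<Longrightarrow> g v = L v" and "\<And>x. g x \<le> p x"
proof -
  have "- p (- v) \<le> L v" if "v \<in> V" for v
    using Lp[of "- v"] that V L by (simp add: subspace_neg linear_neg)
  then obtain r where r: "sublinear r" "\<And>x. r x \<le> p x" "\<And>v. v \<in> V \<Longrightarrow> r v \<le> L v"
    using sublinear_inf_convolution[OF p subspace_imp_convex_cone[OF V]
        linear_imp_sublinear_on[OF L]] by blast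
  obtain g where g: "sublinear g" "g \<le> r" and "\<And>r. sublinear r \<Longrightarrow> r \<le> g \<Longrightarrow> r = g"
    using minimal_sublinear_exists[OF r(1)] by blast
  then have lin: "linear g"
    by (intro minimal_sublinear_imp_linear)
  have le: "g v \<le> L v" if "v \<in> V" for v
    using g(2) r(3)[OF that] by (meson le_funD order_trans)
  show thesis
  proof
    show "linear g" by (rule lin)
    show "g v = L v" if "v \<in> V" for v
      using le[OF that] le[of "- v"] that V L lin
      by (simp add: subspace_neg linear_neg)
    show "g x \<le> p x" for x
      using g(2) r(2)[of x] by (meson le_funD order_trans)
  qed
qed

corollary Hahn_Banach_norm:
  fixes L :: "'a::real_normed_vector \<Rightarrow> real"
  assumes V: "subspace V" and L: "linear L" and M: "0 \<le> M"
    and bound: "\<And>v. v \<in> V \<Longrightarrow> L v \<le> M * norm v"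
  obtains g :: "'a \<Rightarrow>\<^sub>L real"
  where "\<And>v. v \<in> V \<Longrightarrow> blinfun_apply g v = L v" and "norm g \<le> M"
proof -
  have "sublinear (\<lambda>x::'a. M * norm x)"
  proof (rule sublinear_onI)
    show "M * norm (x + y) \<le> M * norm x + M * norm y" for x y :: 'a
      using mult_left_mono[OF norm_triangle_ineq M, of x y] by (simp add: algebra_simps)
  qed simp
  then obtain g where g: "linear g" "\<And>v. v \<in> V \<Longrightarrow> g v = L v" "\<And>x. g x \<le> M * norm x"
    using Hahn_Banach_sublinear[OF _ V L bound] by blast
  have abs: "norm (g x) \<le> M * norm x" for x
    using g(3)[of x] g(3)[of "- x"] linear_neg[OF g(1), of x] by simp
  have bl: "bounded_linear g"
    using g(1) abs by (auto simp: bounded_linear_def bounded_linear_axioms_def mult.commute)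
  show thesis
  proof
    show "blinfun_apply (Blinfun g) v = L v" if "v \<in> V" for v
      using g(2)[OF that] bl by (simp add: bounded_linear_Blinfun_apply)
    show "norm (Blinfun g) \<le> M"
      using abs bl by (intro norm_blinfun_bound[OF M]) (simp add: bounded_linear_Blinfun_apply)
  qed
qed

section \<open>Interpolation and norm duality\<close>

lemma linear_prescribed_on_independent_family:
  fixes \<nu> :: "'n::finite \<Rightarrow> 'a::real_vector" and y :: "real ^ 'n"
  assumes "inj \<nu>" and "independent (range \<nu>)"
  obtains L :: "'a \<Rightarrow> real" where "linear L" and "\<And>j. L (\<nu> j) = y $ j"
proof -
  obtain L where "linear L" "\<And>x. x \<in> range \<nu> \<Longrightarrow> L x = y $ inv \<nu> x"
    using linear_independent_extend[OF assms(2), of "\<lambda>x. y $ inv \<nu> x"] by blast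
  then show thesis
    using that assms(1) by (metis inv_f_f rangeI)
qed

text \<open>
  Every vector of the span is thus reached by some coefficient vector, so a bound for all
  combinations is a bound on the whole subspace to which the Hahn-Banach theorem applies.
\<close>

lemma span_range_eq_combinations:
  fixes \<nu> :: "'n::finite \<Rightarrow> 'a::real_vector"
  shows "span (range \<nu>) = range (\<lambda>c :: real ^ 'n. \<Sum>j\<in>UNIV. c $ j *\<^sub>R \<nu> j)"
proof
  let ?S = "\<lambda>c :: real ^ 'n. \<Sum>j\<in>UNIV. c $ j *\<^sub>R \<nu> j"
  have lin: "linear ?S"
    by (rule linearI) (simp_all add: scaleR_add_left sum.distrib scaleR_sum_right)
  have "\<nu> j = ?S (axis j 1)" for j
    by (simp add: axis_def if_distrib[of "\<lambda>t. t *\<^sub>R _"] cong: if_cong)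
  then have "range \<nu> \<subseteq> range ?S" by blast
  then show "span (range \<nu>) \<subseteq> range ?S"
    by (rule span_minimal) (rule linear_subspace_image[OF lin subspace_UNIV])
  show "range ?S \<subseteq> span (range \<nu>)"
    by (auto intro!: span_sum span_scale intro: span_base)
qed

text \<open>
  The functional \<open>g / M\<close> is dominated by the norm and agrees with it at \<open>M u\<close>; such a functional
  supports the norm at that point.
\<close>

lemma scaled_maximizer_subgradient:
  fixes g :: "'a::real_normed_vector \<Rightarrow>\<^sub>L real"
  assumes M: "0 < M" and g: "norm g \<le> M" and u: "norm u = 1" and gu: "blinfun_apply g u = M"
  shows "(1 / M) *\<^sub>R g \<in> subdifferential norm (M *\<^sub>R u)"
  unfolding subdifferential_def mem_Collect_eq
proof
  fix z
  have "blinfun_apply g z \<le> M * norm z"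
    using norm_blinfun[of g z] mult_right_mono[OF g norm_ge_zero[of z]] by simp
  then show "blinfun_apply ((1 / M) *\<^sub>R g) (z - M *\<^sub>R u) \<le> norm z - norm (M *\<^sub>R u)"
    using M u gu by (simp add: blinfun.diff_right blinfun.scaleR_right blinfun.scaleR_left field_simps)
qed

theorem proposition37:
  fixes J :: "'b::banach \<Rightarrow> ('a::banach \<Rightarrow>\<^sub>L real)"
    and \<nu> :: "'n::finite \<Rightarrow> 'a"
    and y c_hat :: "real ^ 'n"
    and m0 :: real
    and \<nu>_hat :: 'a
  assumes "predual_identification J"
    and "inj \<nu>" and "independent (range \<nu>)"
    and "y \<noteq> 0"
    and "m0 = (INF f\<in>interpolants J \<nu> y. norm f)"
    and "is_arg_max (\<lambda>c :: real ^ 'n. \<Sum>j\<in>UNIV. c $ j * y $ j)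
           (\<lambda>c. norm (\<Sum>j\<in>UNIV. c $ j *\<^sub>R \<nu> j) = 1) c_hat"
    and "\<nu>_hat = m0 *\<^sub>R (\<Sum>j\<in>UNIV. c_hat $ j *\<^sub>R \<nu> j)"
  shows "(\<lambda>f. norm \<nu>_hat *\<^sub>R f) ` predual_norm_subdifferential J \<nu>_hat \<inter> interpolants J \<nu> y \<noteq> {}"
proof -
  have J: "linear J" "bij J" "\<And>f. norm (J f) = norm f"
    using assms(1) by (auto simp: predual_identification_def)
  define S where "S = (\<lambda>c :: real ^ 'n. \<Sum>j\<in>UNIV. c $ j *\<^sub>R \<nu> j)"
  define M where "M = (\<Sum>j\<in>UNIV. c_hat $ j * y $ j)"
  define u where "u = S c_hat"
  obtain L :: "'a \<Rightarrow> real" where L: "linear L" and L\<nu>: "\<And>j. L (\<nu> j) = y $ j"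
    using linear_prescribed_on_independent_family[OF assms(2,3)] by blast
  have LS: "L (S c) = (\<Sum>j\<in>UNIV. c $ j * y $ j)" for c
    by (simp add: S_def linear_sum[OF L] linear_scale[OF L] L\<nu>)
  have u: "norm u = 1" and Lu: "L u = M"
    using assms(6) by (auto simp: is_arg_max_def u_def S_def M_def LS[unfolded S_def])
  have max: "L (S c) \<le> M" if "norm (S c) = 1" for c
    using assms(6) that unfolding LS by (auto simp: is_arg_max_def M_def S_def not_less)
  have S_scale: "S (t *\<^sub>R c) = t *\<^sub>R S c" for t c
    by (simp add: S_def scaleR_sum_right)
  \<comment> \<open>The bound on the unit sphere of the span passes to the whole span by normalizing.\<close>
  have bound: "L (S c) \<le> M * norm (S c)" for c
  proof (cases "S c = 0")
    case True
    then show ?thesis using linear_0[OF L] by simp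
  next
    case False
    then have "L (S (inverse (norm (S c)) *\<^sub>R c)) \<le> M"
      by (intro max) (simp add: S_scale)
    then show ?thesis
      using False by (simp add: S_scale linear_scale[OF L] field_simps)
  qed
  \<comment> \<open>At the coefficient vector \<open>y\<close> itself the functional takes the value \<open>inner y y\<close>.\<close>
  have "0 < L (S y)"
    unfolding LS using assms(4)
    by (metis inner_gt_zero_iff inner_vec_def inner_real_def sum.cong)
  then have M: "0 < M"
    using bound[of y] by (smt (verit) mult_nonpos_nonneg norm_ge_zero)
  obtain g where g: "\<And>v. v \<in> span (range \<nu>) \<Longrightarrow> blinfun_apply g v = L v" "norm g \<le> M"
  proof (rule Hahn_Banach_norm[OF subspace_span L, of M "range \<nu>"])
    show "L v \<le> M * norm v" if "v \<in> span (range \<nu>)" for v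
      using that bound unfolding span_range_eq_combinations S_def by blast
  qed (use M in auto)
  have u_span: "u \<in> span (range \<nu>)"
    unfolding span_range_eq_combinations u_def S_def by blast
  have gu: "blinfun_apply g u = M"
    using g(1)[OF u_span] Lu by simp
  define f0 where "f0 = inv J g"
  have Jf0: "J f0 = g"
    using J(2) by (simp add: f0_def bij_is_surj surj_f_inv_f)
  have f0: "f0 \<in> interpolants J \<nu> y"
    by (simp add: interpolants_def Jf0 g(1) span_base L\<nu>)
  have lower: "M \<le> norm f" if "f \<in> interpolants J \<nu> y" for f
  proof -
    have "blinfun_apply (J f) u = M"
      using that by (simp add: interpolants_def u_def S_def M_def blinfun.sum_right blinfun.scaleR_right)
    then show ?thesis
      using norm_blinfun[of "J f" u] u M J(3)[of f] by simp
  qed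
  have "m0 = M"
  proof (rule antisym)
    have "m0 \<le> norm f0"
      unfolding assms(5) by (rule cINF_lower[OF bdd_belowI2 f0]) (rule lower)
    then show "m0 \<le> M" using g(2) J(3)[of f0] Jf0 by simp
    show "M \<le> m0"
      unfolding assms(5) by (rule cINF_greatest) (use f0 lower in auto)
  qed
  then have hat: "\<nu>_hat = M *\<^sub>R u"
    using assms(7) by (simp add: u_def S_def)
  have "(1 / M) *\<^sub>R f0 \<in> predual_norm_subdifferential J \<nu>_hat"
    using scaled_maximizer_subgradient[OF M g(2) u gu]
    by (simp add: predual_norm_subdifferential_def hat linear_scale[OF J(1)] Jf0)
  moreover have "norm \<nu>_hat *\<^sub>R ((1 / M) *\<^sub>R f0) = f0"
    using M u by (simp add: hat)
  ultimately have "f0 \<in> (\<lambda>f. norm \<nu>_hat *\<^sub>R f) ` predual_norm_subdifferential J \<nu>_hat"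
    by (metis imageI)
  with f0 show ?thesis by blast
qed

end
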